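(* The Hankel determinants $H_n(x)$, $n\ge 0$, form an orthogonal family of polynomials.
   Context: For $k\ge 0$ let $a_k(x)=\sum_{m=0}^{k}\binom{2k+1-m}{k-m}x^m$, and for $n\ge 0$ let $H_n(x)=\det[a_{i+j}(x)]_{0\le i,j\le n}$ be the $(n+1)\times(n+1)$ Hankel determinant. A sequence of real polynomials $(P_n)_{n\ge 0}$ with $\deg P_n=n$ is an orthogonal family if there is a positive Borel measure $\mu$ on $\mathbb{R}$ with finite moments of all orders such that $\int P_mP_n\,d\mu=0$ for $m\ne n$ and $\int P_n^2\,d\mu>0$ for all $n$. *)

theory Defs
  imports
    "HOL-Analysis.Analysis"
    "HOL-Computational_Algebra.Polynomial"
    "Jordan_Normal_Form.Determinant"
begin

definition a_poly :: "nat \<Rightarrow> real poly" where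
  "a_poly k = (\<Sum>m=0..k. monom (of_nat ((2 * k + 1 - m) choose (k - m))) m)"

text \<open>The names are qualified because \<open>HOL-Analysis\<close> also provides constants
  \<open>mat\<close> and \<open>det\<close>, for matrices whose dimension is a type.\<close>

definition hankel_det :: "nat \<Rightarrow> real poly" where
  "hankel_det n = Determinant.det (Matrix.mat (n + 1) (n + 1) (\<lambda>(i, j). a_poly (i + j)))"

text \<open>The integrals below are Bochner integrals, which default to \<open>0\<close> for
  non-integrable functions; the moment condition makes every polynomial integrable, so this
  default is never used.\<close>

definition orthogonal_family :: "(nat \<Rightarrow> real poly) \<Rightarrow> bool" where
  "orthogonal_family P \<longleftrightarrow>
     (\<forall>n. degree (P n) = n) \<and>
     (\<exists>\<mu> :: real measure.
        sets \<mu> = sets borel \<and>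
        (\<forall>k::nat. integrable \<mu> (\<lambda>x. x ^ k)) \<and>
        (\<forall>m n. m \<noteq> n \<longrightarrow> (\<integral>x. poly (P m) x * poly (P n) x \<partial>\<mu>) = 0) \<and>
        (\<forall>n. (\<integral>x. (poly (P n) x)\<^sup>2 \<partial>\<mu>) > 0))"

end

theory Submission
  imports Defs "HOL-Computational_Algebra.Formal_Laurent_Series"
begin

text \<open>
  The family turns out to be a rescaled family of Chebyshev polynomials of the third kind:
  \<open>H\<^sub>0 = 1\<close>, \<open>H\<^sub>1 = 1 - 2x\<close> and \<open>H\<^sub>n\<^sub>+\<^sub>2 = (2 - 2x) H\<^sub>n\<^sub>+\<^sub>1 - H\<^sub>n\<close>
  (\<open>hankel_det_0\<close>, \<open>hankel_det_1\<close>, \<open>hankel_det_rec\<close>).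

  To see this, put \<open>q = x - 1\<close>, \<open>Y = (1 + t)\<^sup>2 / t = t + 2 + 1/t\<close> and
  \<open>\<phi> = (1 + t)\<^sup>2 / (1 - q t)\<close>. Expanding \<open>1 / ((1 + t) - x t)\<close> geometrically shows that \<open>a\<^sub>k(x)\<close>
  is the constant term of the Laurent series \<open>Y\<^sup>k \<phi>\<close> (\<open>constant_term_moment\<close>). The Hankel matrix is
  therefore the Gram matrix of \<open>1, Y, Y\<^sup>2, \<dots>\<close> for the bilinear form sending \<open>f\<close> and \<open>g\<close> to the
  constant term of \<open>f g \<phi>\<close>, and its determinant does not change if the powers of \<open>Y\<close> are replaced
  by other monic polynomials \<open>P\<^sub>n(Y)\<close> of degree \<open>n\<close>. A good choice is \<open>P\<^sub>0 = 1\<close> and, for \<open>n \<ge> 1\<close>,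
  \<open>P\<^sub>n(Y) = (t\<^sup>n (t - q) + t\<^sup>-\<^sup>n (1 - q t)) / (1 + t)\<close>,
  which is invariant under \<open>t \<mapsto> 1/t\<close> and hence a polynomial in \<open>Y\<close>. Unless \<open>m = n = 0\<close>, the
  denominators in \<open>P\<^sub>m P\<^sub>n \<phi>\<close> cancel in all terms that can contribute to the constant term, and
  one reads off that the Gram matrix of the \<open>P\<^sub>n\<close> is tridiagonal, with diagonal
  \<open>1, 2 - 2x, 2 - 2x, \<dots>\<close> and off-diagonal entries \<open>1\<close> (\<open>gram_entry_le\<close>, \<open>gram_entry_far\<close>).
  Laplace expansion of a tridiagonal determinant gives the recurrence.

  The recurrence implies \<open>H\<^sub>n(1 - cos \<theta>) cos (\<theta>/2) = cos ((n + 1/2) \<theta>)\<close>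
  (\<open>poly_hankel_det_cos\<close>). As \<open>1 + cos \<theta> = 2 cos\<^sup>2 (\<theta>/2)\<close>, orthogonality of the cosines on
  \<open>[0, \<pi>]\<close> is orthogonality of the \<open>H\<^sub>n\<close> for the image of the measure
  \<open>(1 + cos \<theta>) d\<theta>\<close> on \<open>[0, \<pi>]\<close> under \<open>\<theta> \<mapsto> 1 - cos \<theta>\<close>.
\<close>

section \<open>Two facts about determinants\<close>

lemma det_tridiagonal_rec:
  fixes f :: "nat \<Rightarrow> nat \<Rightarrow> 'a :: comm_ring_1"
  assumes far: "\<And>i j. i + 1 < j \<or> j + 1 < i \<Longrightarrow> f i j = 0"
  defines "D \<equiv> \<lambda>n. Determinant.det (Matrix.mat n n (\<lambda>(i, j). f i j))"
  shows "D (n + 2) = f (n + 1) (n + 1) * D (n + 1) - f n (n + 1) * f (n + 1) n * D n"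
proof -
  define A where "A = Matrix.mat (n + 2) (n + 2) (\<lambda>(i, j). f i j)"
  define B where "B = mat_delete A (n + 1) n"
  have A: "A \<in> carrier_mat (n + 2) (n + 2)" and B: "B \<in> carrier_mat (n + 1) (n + 1)"
    by (auto simp: A_def B_def)
  \<comment> \<open>The minor \<open>B\<close> is expanded along its last column, where only the bottom entry survives.\<close>
  have zB: "B $$ (i, n) * cofactor B i n = 0" if "i < n" for i
    using that by (simp add: A_def B_def mat_delete_def far)
  have "mat_delete B n n = Matrix.mat n n (\<lambda>(i, j). f i j)"
    by (rule eq_matI) (auto simp: A_def B_def mat_delete_def)
  hence "cofactor B n n = D n"
    by (simp add: cofactor_def D_def)
  moreover have "B $$ (n, n) = f n (n + 1)"
    by (simp add: A_def B_def mat_delete_def)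
  ultimately have detB: "Determinant.det B = f n (n + 1) * D n"
    using laplace_expansion_column[OF B, of n] zB by simp
  have zA: "A $$ (n + 1, j) * cofactor A (n + 1) j = 0" if "j < n" for j
    using that by (simp add: A_def far)
  have "mat_delete A (n + 1) (n + 1) = Matrix.mat (n + 1) (n + 1) (\<lambda>(i, j). f i j)"
    by (rule eq_matI) (auto simp: A_def mat_delete_def)
  hence "cofactor A (n + 1) (n + 1) = D (n + 1)"
    by (simp add: cofactor_def D_def)
  moreover have "cofactor A (n + 1) n = - (f n (n + 1) * D n)"
    using detB by (simp add: cofactor_def B_def)
  moreover have "D (n + 2) = (\<Sum>j<n + 2. A $$ (n + 1, j) * cofactor A (n + 1) j)"
    unfolding D_def using laplace_expansion_row[OF A, of "n + 1"] by (simp add: A_def)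
  ultimately show ?thesis
    using zA by (simp add: A_def algebra_simps)
qed

text \<open>Congruence by a lower unitriangular matrix, that is, a change of basis that adds to each
  basis vector a combination of earlier ones, preserves the Gram determinant.\<close>

lemma det_gram_unitriangular:
  fixes f c :: "nat \<Rightarrow> nat \<Rightarrow> 'a :: comm_ring_1"
  assumes upper: "\<And>i k. i < k \<Longrightarrow> c i k = 0" and diag: "\<And>i. c i i = 1"
  shows "Determinant.det (Matrix.mat N N (\<lambda>(i, j). \<Sum>k<N. \<Sum>l<N. c i k * f k l * c j l)) =
         Determinant.det (Matrix.mat N N (\<lambda>(i, j). f i j))"
proof -
  define C where "C = Matrix.mat N N (\<lambda>(i, j). c i j)"
  define F where "F = Matrix.mat N N (\<lambda>(i, j). f i j)"
  have C: "C \<in> carrier_mat N N" and F: "F \<in> carrier_mat N N"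
    by (auto simp: C_def F_def)
  have "diag_mat C = replicate N 1"
    by (rule nth_equalityI) (auto simp: diag_mat_def C_def diag)
  hence detC: "Determinant.det C = 1"
    using det_lower_triangular[of N C] C upper by (auto simp: C_def)
  have "Matrix.mat N N (\<lambda>(i, j). \<Sum>k<N. \<Sum>l<N. c i k * f k l * c j l) = C * F * C\<^sup>T"
  proof (rule eq_matI, goal_cases)
    case (1 i j)
    thus ?case
      by (simp add: C_def F_def scalar_prod_def sum_distrib_left sum_distrib_right
          lessThan_atLeast0 mult.assoc) (rule sum.swap)
  qed (auto simp: C_def)
  thus ?thesis
    using C F detC by (simp add: det_mult[of _ N] det_transpose[of _ N] F_def)
qed

section \<open>The entries as constant terms of Laurent series\<close>

lemma fls_nth_0_X_power_times:
  "fls_nth (fls_X ^ k * fps_to_fls f) 0 = (if k = 0 then fps_nth f 0 else 0)"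
  for f :: "'a :: comm_ring_1 fps"
  by (simp add: fls_X_power_times_conv_shift)

lemma fls_nth_0_X_inv_power_times:
  "fls_nth (fls_X_inv ^ k * fps_to_fls f) 0 = fps_nth f k"
  for f :: "'a :: comm_ring_1 fps"
  by (simp add: fls_X_inv_power_times_conv_shift)

text \<open>The series \<open>1 / (1 - q t)\<close>, given by its coefficients so that it makes sense over any
  commutative ring.\<close>

definition geometric_fps :: "'a :: comm_ring_1 \<Rightarrow> 'a fps" where
  "geometric_fps q = Abs_fps (\<lambda>n. q ^ n)"

lemma geometric_fps: "(1 - fps_const q * fps_X) * geometric_fps q = 1"
proof (rule fps_ext)
  fix n show "fps_nth ((1 - fps_const q * fps_X) * geometric_fps q) n = fps_nth 1 n"
    by (cases n) (simp_all add: geometric_fps_def left_diff_distrib mult.assoc)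
qed

text \<open>The weight \<open>\<phi> = (1 + t)\<^sup>2 / (1 - (x - 1) t)\<close> and the Laurent polynomial
  \<open>Y = (1 + t)\<^sup>2 / t\<close>. The latter is the Joukowski expression \<open>t + 1/t\<close> shifted by \<open>2\<close>; see
  \<open>joukowski_fls_eq\<close> below.\<close>

definition hankel_weight :: "'a :: comm_ring_1 \<Rightarrow> 'a fps" where
  "hankel_weight x = (1 + fps_X)\<^sup>2 * geometric_fps (x - 1)"

definition joukowski_fls :: "'a :: comm_ring_1 fls" where
  "joukowski_fls = fls_X_inv * (1 + fls_X)\<^sup>2"

lemma fps_nth_one_plus_X_power:
  "fps_nth ((1 + fps_X :: 'a :: comm_ring_1 fps) ^ n) k = of_nat (n choose k)"
proof (induction n arbitrary: k)
  case 0
  then show ?case by (cases k) auto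
next
  case (Suc n)
  then show ?case by (cases k) (simp_all add: distrib_right add.commute)
qed

lemma constant_term_moment:
  fixes x :: "'a :: comm_ring_1"
  shows "fls_nth (joukowski_fls ^ k * fps_to_fls (hankel_weight x)) 0 =
         (\<Sum>m=0..k. of_nat ((2 * k + 1 - m) choose (k - m)) * x ^ m)"
proof -
  define s :: "'a fps" where "s = 1 + fps_X"
  define y where "y = fps_const x * fps_X"
  define G where "G = geometric_fps (x - 1)"
  have "1 - fps_const (x - 1) * fps_X = s - y"
    by (simp add: s_def y_def algebra_simps flip: fps_const_sub)
  hence G: "(s - y) * G = 1"
    using geometric_fps[of "x - 1"] by (simp add: G_def)
  \<comment> \<open>Truncated geometric expansion of \<open>1 / (s - y)\<close>: the remainder \<open>y ^ Suc k\<close> is divisible by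
    \<open>t ^ Suc k\<close> and does not reach the coefficient of \<open>t ^ k\<close>.\<close>
  have "s ^ Suc k = y ^ Suc k + (s - y) * (\<Sum>m<Suc k. y ^ m * s ^ (k - m))"
    using diff_power_eq_sum[of y k s]
    by (simp add: algebra_simps del: sum.lessThan_Suc power_Suc)
  hence "s ^ Suc k * G = (y ^ Suc k + (s - y) * (\<Sum>m<Suc k. y ^ m * s ^ (k - m))) * G"
    by (rule arg_cong)
  also have "\<dots> = y ^ Suc k * G + ((s - y) * G) * (\<Sum>m<Suc k. y ^ m * s ^ (k - m))"
    by (simp only: distrib_right distrib_left mult_ac)
  finally have "s ^ Suc k * (s ^ Suc k * G) =
      s ^ Suc k * (y ^ Suc k * G + (\<Sum>m<Suc k. y ^ m * s ^ (k - m)))"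
    unfolding G by (simp only: mult_1_left)
  hence "s ^ Suc k * s ^ Suc k * G =
      s ^ Suc k * (y ^ Suc k * G) + (\<Sum>m<Suc k. y ^ m * (s ^ Suc k * s ^ (k - m)))"
    by (simp only: distrib_left sum_distrib_left mult_ac)
  also have "s ^ Suc k * (y ^ Suc k * G) = fps_X ^ Suc k * (fps_const x ^ Suc k * s ^ Suc k * G)"
    by (simp add: y_def power_mult_distrib mult_ac)
  finally have "fps_nth (s ^ Suc k * s ^ Suc k * G) k =
      (\<Sum>m<Suc k. fps_nth (y ^ m * (s ^ Suc k * s ^ (k - m))) k)"
    by (simp add: fps_X_power_mult_nth fps_sum_nth del: power_Suc sum.lessThan_Suc)
  also have "\<dots> = (\<Sum>m<Suc k. of_nat ((2 * k + 1 - m) choose (k - m)) * x ^ m)"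
  proof (rule sum.cong)
    fix m assume "m \<in> {..<Suc k}"
    hence "Suc k + (k - m) = 2 * k + 1 - m" and "m \<le> k" by auto
    thus "fps_nth (y ^ m * (s ^ Suc k * s ^ (k - m))) k =
        of_nat ((2 * k + 1 - m) choose (k - m)) * x ^ m"
      by (simp add: y_def s_def power_mult_distrib fps_const_power mult.assoc mult.commute
          fps_X_power_mult_nth fps_nth_one_plus_X_power flip: power_add del: power_Suc)
  qed simp
  also have "{..<Suc k} = {0..k}" by auto
  also have "s ^ Suc k * s ^ Suc k * G = s ^ (2 * k) * hankel_weight x"
    unfolding hankel_weight_def s_def G_def
    by (simp add: power_add mult_2 power2_eq_square)
  finally show ?thesis
    by (simp add: joukowski_fls_def power_mult_distrib s_def fls_nth_0_X_inv_power_times mult.assoc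
        fls_times_fps_to_fls fps_to_fls_power flip: power_mult)
       (simp flip: fls_nth_0_X_inv_power_times add: fls_times_fps_to_fls fps_to_fls_power)
qed


section \<open>A basis with tridiagonal Gram matrix\<close>

text \<open>Substitution of \<open>Y\<close> into a polynomial.\<close>

definition eval_joukowski :: "'a :: comm_ring_1 poly \<Rightarrow> 'a fls" where
  "eval_joukowski p = poly (map_poly fls_const p) joukowski_fls"

lemma eval_joukowski_pCons:
  "eval_joukowski (pCons c p) = fls_const c + joukowski_fls * eval_joukowski p"
  by (cases "c = 0 \<and> p = 0") (auto simp: eval_joukowski_def map_poly_pCons)

lemma eval_joukowski_const: "eval_joukowski [:c:] = fls_const c"
  by (simp add: eval_joukowski_def map_poly_pCons)

lemma eval_joukowski_diff: "eval_joukowski (p - r) = eval_joukowski p - eval_joukowski r"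
proof -
  have "map_poly fls_const (p - r) = map_poly fls_const p - map_poly fls_const r"
    by (rule poly_eqI) (simp add: coeff_map_poly fls_minus_const)
  thus ?thesis by (simp add: eval_joukowski_def)
qed

lemma eval_joukowski_smult: "eval_joukowski (Polynomial.smult c p) = fls_const c * eval_joukowski p"
proof -
  have "map_poly fls_const (Polynomial.smult c p) =
      Polynomial.smult (fls_const c) (map_poly fls_const p)"
    by (rule poly_eqI) (simp add: coeff_map_poly)
  thus ?thesis by (simp add: eval_joukowski_def)
qed

lemma eval_joukowski_eq_sum:
  assumes "\<And>k. k \<ge> N \<Longrightarrow> coeff p k = 0"
  shows "eval_joukowski p = (\<Sum>k<N. fls_const (coeff p k) * joukowski_fls ^ k)"
proof -
  have "eval_joukowski p =
      (\<Sum>k\<le>degree (map_poly fls_const p). fls_const (coeff p k) * joukowski_fls ^ k)"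
    by (simp add: eval_joukowski_def poly_altdef coeff_map_poly)
  also have "degree (map_poly fls_const p) = degree p"
    by (rule degree_map_poly) auto
  also have "(\<Sum>k\<le>degree p. fls_const (coeff p k) * joukowski_fls ^ k) =
      (\<Sum>k<N. fls_const (coeff p k) * joukowski_fls ^ k)"
    by (rule sum.mono_neutral_cong) (use assms in \<open>auto simp: coeff_eq_0 not_less not_le\<close>)
  finally show ?thesis .
qed

text \<open>The polynomials \<open>Q\<^sub>n\<close> with
  \<open>Q\<^sub>n(Y) = (t\<^sup>n (t - q) + t\<^sup>-\<^sup>n (1 - q t)) / (1 + t)\<close> and \<open>q = x - 1\<close>, shown to have this value in
  \<open>one_plus_X_times_chebyshev_aux\<close>. They satisfy the Chebyshev recurrence in \<open>Y - 2 = t + 1/t\<close>.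
  For \<open>n > 0\<close> they are monic of degree \<open>n\<close>, but \<open>Q\<^sub>0\<close> is the constant \<open>2 - x\<close>, so it is
  replaced by \<open>1\<close> to obtain a basis.\<close>

fun chebyshev_aux :: "'a :: comm_ring_1 \<Rightarrow> nat \<Rightarrow> 'a poly" where
  "chebyshev_aux x 0 = [:2 - x:]"
| "chebyshev_aux x (Suc 0) = [:- (2 + x), 1:]"
| "chebyshev_aux x (Suc (Suc n)) =
     pCons 0 (chebyshev_aux x (Suc n)) - Polynomial.smult 2 (chebyshev_aux x (Suc n)) - chebyshev_aux x n"

definition gram_basis :: "'a :: comm_ring_1 \<Rightarrow> nat \<Rightarrow> 'a poly" where
  "gram_basis x n = (if n = 0 then 1 else chebyshev_aux x n)"

lemma coeff_chebyshev_aux: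
  "k \<ge> n \<Longrightarrow> coeff (chebyshev_aux x n) k = (if k = n then if n = 0 then 2 - x else 1 else 0)"
  by (induction x n arbitrary: k rule: chebyshev_aux.induct)
     (auto simp: coeff_pCons split: nat.splits)

lemma coeff_gram_basis: "coeff (gram_basis x n) n = 1"
  and coeff_gram_basis_above: "n < k \<Longrightarrow> coeff (gram_basis x n) k = 0"
  by (simp_all add: gram_basis_def coeff_chebyshev_aux coeff_1)

lemma fls_X_inv_X: "fls_X_inv * (fls_X :: 'a :: comm_ring_1 fls) = 1"
    "fls_X_inv * (fls_X * z) = (z :: 'a fls)"
    "fls_X * (fls_X_inv * z) = (z :: 'a fls)"
    "fls_X * (fls_X_inv :: 'a fls) = 1"
  by (simp_all add: fls_X_inv_times_conv_shift fls_X_times_conv_shift)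

lemma joukowski_fls_eq: "joukowski_fls = fls_X_inv + 2 + (fls_X :: 'a :: comm_ring_1 fls)"
  by (simp add: joukowski_fls_def power2_eq_square algebra_simps fls_X_inv_X)

lemma one_plus_X_times_chebyshev_aux:
  fixes x :: "'a :: comm_ring_1"
  shows "(1 + fls_X) * eval_joukowski (chebyshev_aux x n) =
     fls_X ^ n * (fls_X - fls_const (x - 1)) + fls_X_inv ^ n * (1 - fls_const (x - 1) * fls_X)"
proof (induction x n rule: chebyshev_aux.induct)
  case (1 x)
  show ?case
    by (simp add: eval_joukowski_const algebra_simps flip: fls_minus_const)
next
  case (2 x)
  show ?case
    by (subst chebyshev_aux.simps, subst eval_joukowski_pCons)
       (simp add: eval_joukowski_const joukowski_fls_eq algebra_simps
        fls_X_inv_X flip: fls_minus_const fls_plus_const)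
next
  case (3 x n)
  have "(1 + fls_X) * eval_joukowski (chebyshev_aux x (Suc (Suc n))) =
      (fls_X_inv + fls_X) * ((1 + fls_X) * eval_joukowski (chebyshev_aux x (Suc n))) -
      (1 + fls_X) * eval_joukowski (chebyshev_aux x n)"
    unfolding chebyshev_aux.simps eval_joukowski_diff eval_joukowski_smult eval_joukowski_pCons
      joukowski_fls_eq
    by (simp add: algebra_simps)
  also have "\<dots> = fls_X ^ Suc (Suc n) * (fls_X - fls_const (x - 1)) +
      fls_X_inv ^ Suc (Suc n) * (1 - fls_const (x - 1) * fls_X)"
    unfolding 3 by (simp add: algebra_simps fls_X_inv_X)
  finally show ?case .
qed

text \<open>The two lemmas below hold the cancellation at the heart of the argument: when the products
  are expanded by the closed form of \<open>(1 + t) Q\<^sub>n(Y)\<close>, every term with a factor \<open>t\<^sup>-\<^sup>n\<close> or \<open>t\<^sup>-\<^sup>m\<close> contains a factor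
  \<open>1 - q t\<close>, which cancels the denominator of the weight. Only the first term of each right-hand
  side may keep that denominator, and it has positive order in \<open>t\<close> if \<open>n > 0\<close>.\<close>

lemma gram_chebyshev_aux:
  fixes x :: "'a :: comm_ring_1"
  assumes "m \<le> n" and "n > 0"
  shows "eval_joukowski (chebyshev_aux x m) * eval_joukowski (chebyshev_aux x n) *
      fps_to_fls (hankel_weight x) =
    fls_X ^ (n + m) * fps_to_fls ((fps_X - fps_const (x - 1))\<^sup>2 * geometric_fps (x - 1)) +
    fls_X ^ (n - m) * fps_to_fls (fps_X - fps_const (x - 1)) +
    fls_X_inv ^ (n - m) * fps_to_fls (fps_X - fps_const (x - 1)) +
    fls_X_inv ^ (n + m) * fps_to_fls (1 - fps_const (x - 1) * fps_X)"
proof -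
  define u where "u = fls_X - fls_const (x - 1)"
  define v where "v = 1 - fls_const (x - 1) * fls_X"
  define G where "G = fps_to_fls (geometric_fps (x - 1))"
  obtain d where n: "n = m + d"
    using assms(1) le_Suc_ex by blast
  have XW: "fls_X_inv ^ m * (fls_X :: 'a fls) ^ m = 1"
    by (simp add: fls_X_inv_X flip: power_mult_distrib)
  have vG: "v * G = 1"
    using arg_cong[OF geometric_fps[of "x - 1"], of fps_to_fls]
    by (simp add: v_def G_def fls_times_fps_to_fls)
  have "eval_joukowski (chebyshev_aux x m) * eval_joukowski (chebyshev_aux x n) *
      fps_to_fls (hankel_weight x) =
      ((1 + fls_X) * eval_joukowski (chebyshev_aux x m)) *
      ((1 + fls_X) * eval_joukowski (chebyshev_aux x n)) * G"
    by (simp add: hankel_weight_def G_def fls_times_fps_to_fls power2_eq_square mult_ac)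
  also have "\<dots> = (fls_X ^ m * u + fls_X_inv ^ m * v) * (fls_X ^ n * u + fls_X_inv ^ n * v) * G"
    by (simp add: one_plus_X_times_chebyshev_aux u_def v_def)
  also have "\<dots> = fls_X ^ (n + m) * (u\<^sup>2 * G) +
      (fls_X_inv ^ m * fls_X ^ m) * (fls_X ^ d * u) * (v * G) +
      (fls_X_inv ^ m * fls_X ^ m) * (fls_X_inv ^ d * u) * (v * G) +
      fls_X_inv ^ (n + m) * v * (v * G)"
    by (simp add: n algebra_simps power_add power2_eq_square)
  finally show ?thesis
    unfolding XW vG
    by (simp add: n u_def v_def G_def fls_times_fps_to_fls power2_eq_square)
qed

lemma gram_one_chebyshev_aux:
  fixes x :: "'a :: comm_ring_1"
  shows "eval_joukowski (chebyshev_aux x n) * fps_to_fls (hankel_weight x) =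
    fls_X ^ n * fps_to_fls ((1 + fps_X) * (fps_X - fps_const (x - 1)) * geometric_fps (x - 1)) +
    fls_X_inv ^ n * fps_to_fls (1 + fps_X)"
proof -
  define u where "u = fls_X - fls_const (x - 1)"
  define v where "v = 1 - fls_const (x - 1) * fls_X"
  define G where "G = fps_to_fls (geometric_fps (x - 1))"
  have vG: "v * G = 1"
    using arg_cong[OF geometric_fps[of "x - 1"], of fps_to_fls]
    by (simp add: v_def G_def fls_times_fps_to_fls)
  have "eval_joukowski (chebyshev_aux x n) * fps_to_fls (hankel_weight x) =
      (1 + fls_X) * ((1 + fls_X) * eval_joukowski (chebyshev_aux x n)) * G"
    by (simp add: hankel_weight_def G_def fls_times_fps_to_fls power2_eq_square mult_ac)
  also have "\<dots> = (1 + fls_X) * (fls_X ^ n * u + fls_X_inv ^ n * v) * G"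
    by (simp add: one_plus_X_times_chebyshev_aux u_def v_def)
  also have "\<dots> = fls_X ^ n * ((1 + fls_X) * u * G) + fls_X_inv ^ n * (1 + fls_X) * (v * G)"
    by (simp add: algebra_simps)
  finally show ?thesis
    unfolding vG by (simp add: u_def G_def fls_times_fps_to_fls)
qed

text \<open>The Gram matrix of the basis for the form sending \<open>f\<close> and \<open>g\<close> to the constant term of
  \<open>f(Y) g(Y) \<phi>\<close>.\<close>

definition gram_entry :: "'a :: comm_ring_1 \<Rightarrow> nat \<Rightarrow> nat \<Rightarrow> 'a" where
  "gram_entry x i j = fls_nth (eval_joukowski (gram_basis x i) * eval_joukowski (gram_basis x j) *
     fps_to_fls (hankel_weight x)) 0"

lemma gram_entry_commute: "gram_entry x i j = gram_entry x j i"
  by (simp add: gram_entry_def mult.commute)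

lemma gram_entry_le:
  fixes x :: "'a :: comm_ring_1"
  assumes "i \<le> j"
  shows "gram_entry x i j =
    (if i = j then if i = 0 then 1 else 2 - 2 * x else if j = i + 1 then 1 else 0)"
proof -
  have eval_1: "eval_joukowski 1 = (1 :: 'a fls)"
    by (simp add: eval_joukowski_def)
  consider "j = 0" | "i = 0" "j > 0" | "i > 0" by fastforce
  thus ?thesis
  proof cases
    case 1
    with assms show ?thesis
      by (simp add: gram_entry_def gram_basis_def eval_1 hankel_weight_def
          geometric_fps_def power2_eq_square)
  next
    case 2
    then show ?thesis
      by (simp add: gram_entry_def gram_basis_def eval_1 gram_one_chebyshev_aux fls_nth_0_X_power_times
          fls_nth_0_X_inv_power_times fps_X_nth del: fps_to_fls_plus fps_to_fls_minus)
  next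
    case 3
    with assms show ?thesis
      by (simp add: gram_entry_def gram_basis_def gram_chebyshev_aux fls_nth_0_X_power_times
          fls_nth_0_X_inv_power_times fps_X_nth del: fps_to_fls_plus fps_to_fls_minus)
        (auto simp: algebra_simps)
  qed
qed

lemma gram_entry_far: "i + 1 < j \<or> j + 1 < i \<Longrightarrow> gram_entry x i j = 0"
  using gram_entry_le[of i j x] gram_entry_le[of j i x] by (auto simp: gram_entry_commute[of x i j])

lemma fls_nth_sum: "fls_nth (sum f A) n = (\<Sum>i\<in>A. fls_nth (f i) n)"
  by (induction A rule: infinite_finite_induct) auto

lemma gram_entry_expand:
  fixes x :: "'a :: comm_ring_1"
  assumes "i < N" and "j < N"
  defines "a \<equiv> \<lambda>k. fls_nth (joukowski_fls ^ k * fps_to_fls (hankel_weight x)) 0"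
  shows "gram_entry x i j =
    (\<Sum>k<N. \<Sum>l<N. coeff (gram_basis x i) k * a (k + l) * coeff (gram_basis x j) l)"
proof -
  have E: "eval_joukowski (gram_basis x r) =
      (\<Sum>k<N. fls_const (coeff (gram_basis x r) k) * joukowski_fls ^ k)" if "r < N" for r
    using that by (intro eval_joukowski_eq_sum coeff_gram_basis_above) simp
  have "eval_joukowski (gram_basis x i) * eval_joukowski (gram_basis x j) *
      fps_to_fls (hankel_weight x) =
    (\<Sum>k<N. \<Sum>l<N. fls_const (coeff (gram_basis x i) k * coeff (gram_basis x j) l) *
      (joukowski_fls ^ (k + l) * fps_to_fls (hankel_weight x)))"
    unfolding E[OF assms(1)] E[OF assms(2)] sum_product unfolding sum_distrib_right
    by (intro sum.cong refl) (simp only: power_add mult_ac flip: fls_const_mult_const)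
  thus ?thesis
    by (simp add: gram_entry_def a_def fls_nth_sum) (simp add: mult_ac)
qed


section \<open>The Hankel determinants\<close>

lemma a_poly_eq: "a_poly k = (\<Sum>m=0..k. of_nat ((2 * k + 1 - m) choose (k - m)) * [:0, 1:] ^ m)"
  unfolding a_poly_def
  by (intro sum.cong refl) (simp add: monom_altdef of_nat_poly)

lemma hankel_det_eq_det_gram:
  "hankel_det n =
     Determinant.det (Matrix.mat (n + 1) (n + 1) (\<lambda>(i, j). gram_entry [:0, 1:] i j))"
proof -
  have "Matrix.mat (n + 1) (n + 1) (\<lambda>(i, j). gram_entry [:0, 1:] i j) =
      Matrix.mat (n + 1) (n + 1) (\<lambda>(i, j). \<Sum>k<n + 1. \<Sum>l<n + 1.
        coeff (gram_basis [:0, 1:] i) k * a_poly (k + l) * coeff (gram_basis [:0, 1:] j) l)"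
    by (rule cong_mat)
       (auto simp: gram_entry_expand[of _ "n + 1"] constant_term_moment a_poly_eq
         simp del: sum.lessThan_Suc)
  thus ?thesis
    by (simp only: det_gram_unitriangular coeff_gram_basis coeff_gram_basis_above hankel_det_def)
qed

lemma hankel_det_0: "hankel_det 0 = 1"
  by (simp add: hankel_det_eq_det_gram det_single gram_entry_le)

lemma hankel_det_1: "hankel_det (Suc 0) = [:1, -2:]"
  using det_tridiagonal_rec[of "gram_entry [:0, 1 :: real:]" 0, OF gram_entry_far]
  by (simp add: hankel_det_eq_det_gram det_single gram_entry_le gram_entry_commute[of _ "Suc 0" 0]
      numeral_2_eq_2 flip: one_pCons) (simp add: numeral_poly one_pCons)

lemma hankel_det_rec:
  "hankel_det (Suc (Suc n)) = [:2, -2:] * hankel_det (Suc n) - hankel_det n"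
proof -
  have "hankel_det (Suc (Suc n)) = (2 - 2 * [:0, 1:]) * hankel_det (Suc n) - hankel_det n"
    using det_tridiagonal_rec[of "gram_entry [:0, 1 :: real:]" "n + 1", OF gram_entry_far]
    by (simp add: hankel_det_eq_det_gram gram_entry_le
        gram_entry_commute[of _ "Suc (Suc n)" "Suc n"])
  also have "2 - 2 * [:0, 1:] = [:2, -2 :: real:]"
    by (simp add: numeral_poly)
  finally show ?thesis .
qed

lemma coeff_hankel_det: "k \<ge> n \<Longrightarrow> coeff (hankel_det n) k = (if k = n then (-2) ^ n else 0)"
proof (induction n arbitrary: k rule: induct_nat_012)
  case 0
  then show ?case by (simp add: hankel_det_0 coeff_1)
next
  case 1
  then show ?case by (cases k) (auto simp: hankel_det_1 coeff_pCons split: nat.splits)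
next
  case (ge2 n)
  then show ?case by (cases k) (auto simp: hankel_det_rec)
qed

lemma degree_hankel_det: "degree (hankel_det n) = n"
  by (intro antisym degree_le le_degree) (auto simp: coeff_hankel_det)

lemma poly_hankel_det_cos:
  "poly (hankel_det n) (1 - cos t) * cos (t / 2) = cos ((real n + 1 / 2) * t)"
proof -
  have cos_step: "cos (u + v) = 2 * cos v * cos u - cos (u - v)" for u v :: real
    by (simp add: cos_add cos_diff)
  show ?thesis
  proof (induction n rule: induct_nat_012)
    case 0
    then show ?case by (simp add: hankel_det_0)
  next
    case 1
    have "(1 + 1 / 2) * t = t + t / 2" and "t - t / 2 = t / 2"
      by (simp_all add: field_simps)
    hence "cos ((1 + 1 / 2) * t) = 2 * cos t * cos (t / 2) - cos (t / 2)"
      using cos_step[of t "t / 2"] by (simp only: mult_ac)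
    then show ?case by (simp add: hankel_det_1 algebra_simps)
  next
    case (ge2 n)
    have "(real (Suc (Suc n)) + 1 / 2) * t = (real (Suc n) + 1 / 2) * t + t"
      and "(real n + 1 / 2) * t = (real (Suc n) + 1 / 2) * t - t"
      by (simp_all add: algebra_simps)
    hence "cos ((real (Suc (Suc n)) + 1 / 2) * t) =
        2 * cos t * cos ((real (Suc n) + 1 / 2) * t) - cos ((real n + 1 / 2) * t)"
      by (simp only: cos_step)
    also have "\<dots> = poly (hankel_det (Suc (Suc n))) (1 - cos t) * cos (t / 2)"
      unfolding ge2[symmetric] by (simp add: hankel_det_rec algebra_simps)
    finally show ?case ..
  qed
qed

section \<open>Orthogonality\<close>

text \<open>The image of \<open>(1 + cos \<theta>) d\<theta>\<close> on \<open>[0, \<pi>]\<close> under \<open>\<theta> \<mapsto> 1 - cos \<theta>\<close>; this is the measure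
  \<open>sqrt ((2 - y) / y) dy\<close> on \<open>[0, 2]\<close>, in a form whose integrals are trigonometric.\<close>

definition cos_measure :: "real measure" where
  "cos_measure =
     distr (density lborel (\<lambda>t. indicator {0..pi} t * (1 + cos t))) borel (\<lambda>t. 1 - cos t)"

lemma
  fixes f :: "real \<Rightarrow> real"
  assumes f: "f \<in> borel_measurable borel"
  shows integral_cos_measure:
      "(\<integral>y. f y \<partial>cos_measure) =
       (\<integral>t. (1 + cos t) * f (1 - cos t) * indicator {0..pi} t \<partial>lborel)"
    and integrable_cos_measure_iff:
      "integrable cos_measure f \<longleftrightarrow>
       integrable lborel (\<lambda>t. (1 + cos t) * f (1 - cos t) * indicator {0..pi} t)"
proof -
  note [measurable] = f
  have "0 \<le> 1 + cos t" for t :: real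
    using cos_ge_minus_one[of t] by linarith
  hence nonneg: "AE t in lborel. 0 \<le> indicator {0..pi} t * (1 + cos t)"
    by simp
  show "(\<integral>y. f y \<partial>cos_measure) =
       (\<integral>t. (1 + cos t) * f (1 - cos t) * indicator {0..pi} t \<partial>lborel)"
    unfolding cos_measure_def
    by (simp add: integral_distr integral_density nonneg) (simp add: mult_ac)
  show "integrable cos_measure f \<longleftrightarrow>
       integrable lborel (\<lambda>t. (1 + cos t) * f (1 - cos t) * indicator {0..pi} t)"
    unfolding cos_measure_def
    by (simp add: integrable_distr_eq integrable_density nonneg) (simp add: mult_ac)
qed

lemma integral_cos_nat:
  "(\<integral>t. cos (real k * t) * indicator {0..pi} t \<partial>lborel) = (if k = 0 then pi else 0)"
  and integrable_cos_nat: "integrable lborel (\<lambda>t. cos (real k * t) * indicator {0..pi} t)"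
proof -
  define F where "F = (\<lambda>t. if k = 0 then t else sin (real k * t) / real k)"
  have *: "has_bochner_integral lborel (\<lambda>t. cos (real k * t) * indicator {0..pi} t) (F pi - F 0)"
  proof (rule has_bochner_integral_FTC_Icc_real)
    fix t show "DERIV F t :> cos (real k * t)"
      by (cases "k = 0") (auto simp: F_def intro!: derivative_eq_intros)
  qed auto
  show "(\<integral>t. cos (real k * t) * indicator {0..pi} t \<partial>lborel) = (if k = 0 then pi else 0)"
    using has_bochner_integral_integral_eq[OF *] by (simp add: F_def)
  show "integrable lborel (\<lambda>t. cos (real k * t) * indicator {0..pi} t)"
    using * by (rule integrable.intros)
qed

lemma integral_hankel_det_mult:
  assumes "m \<le> n"
  shows "(\<integral>y. poly (hankel_det m) y * poly (hankel_det n) y \<partial>cos_measure) =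
    (if m = n then pi else 0)"
proof -
  have eq: "(1 + cos t) * (poly (hankel_det m) (1 - cos t) * poly (hankel_det n) (1 - cos t)) =
      cos (real (n + m + 1) * t) + cos (real (n - m) * t)" for t
  proof -
    have "1 + cos t = 2 * (cos (t / 2))\<^sup>2"
      using cos_double_cos[of "t / 2"] by simp
    hence "(1 + cos t) * (poly (hankel_det m) (1 - cos t) * poly (hankel_det n) (1 - cos t)) =
        2 * (cos ((real n + 1 / 2) * t) * cos ((real m + 1 / 2) * t))"
      unfolding poly_hankel_det_cos[symmetric] by (simp add: power2_eq_square)
    also have "\<dots> = cos (real (n + m + 1) * t) + cos (real (n - m) * t)"
      unfolding cos_times_cos using assms by (simp add: of_nat_diff algebra_simps)
    finally show ?thesis .
  qed
  have "(\<integral>y. poly (hankel_det m) y * poly (hankel_det n) y \<partial>cos_measure) =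
      (\<integral>t. cos (real (n + m + 1) * t) * indicator {0..pi} t +
            cos (real (n - m) * t) * indicator {0..pi} t \<partial>lborel)"
    unfolding distrib_right[symmetric] eq[symmetric] 
    by (intro integral_cos_measure borel_measurable_continuous_onI continuous_intros)
  also have "\<dots> = (if m = n then pi else 0)"
    using assms
    by (subst Bochner_Integration.integral_add)
       (simp_all only: integrable_cos_nat integral_cos_nat, auto)
  finally show ?thesis .
qed

lemma integrable_power_cos_measure: "integrable cos_measure (\<lambda>y. y ^ k)"
proof -
  have "continuous_on {0..pi} (\<lambda>t. (1 + cos t) * (1 - cos t) ^ k)"
    by (intro continuous_intros)
  hence "integrable lborel (\<lambda>t. indicator {0..pi} t *\<^sub>R ((1 + cos t) * (1 - cos t) ^ k))"
    by (rule borel_integrable_compact[OF compact_Icc])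
  thus ?thesis
    by (subst integrable_cos_measure_iff) (simp_all add: mult_ac)
qed

theorem corollary7: "orthogonal_family hankel_det"
  unfolding orthogonal_family_def
proof (intro conjI exI[of _ cos_measure] allI impI)
  fix m n :: nat
  assume "m \<noteq> n"
  thus "(\<integral>y. poly (hankel_det m) y * poly (hankel_det n) y \<partial>cos_measure) = 0"
    using integral_hankel_det_mult[of m n] integral_hankel_det_mult[of n m]
    by (cases "m \<le> n") (simp_all add: mult.commute)
next
  fix n
  show "0 < (\<integral>y. (poly (hankel_det n) y)\<^sup>2 \<partial>cos_measure)"
    using integral_hankel_det_mult[of n n] by (simp add: power2_eq_square)
qed (simp_all add: degree_hankel_det integrable_power_cos_measure, simp add: cos_measure_def)

end
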